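(* Consider the spacelike geodesics $(\phi(s),\chi_1(s),\chi_2(s))$ (defined in the context) starting from the point $\phi(0)=0$, $\chi_1(0)=0$, $\chi_2(0)=\chi_2^{(0)}$ with some $\dot\phi(0)\ne0$ and a constant value $\dot\chi_2\neq0$ (and no prescribed condition on $\dot\chi_1(s)$). They have the following equations, with an appropriate choice of sign $\pm$: $$\sinh\phi(s)=\pm\sqrt{\frac{\dot\phi^2(0)}{\dot\phi^2(0)+4\dot\chi_2^2}}\;\sinh\!\Big(s\sqrt{\dot\phi^2(0)+4\dot\chi_2^2}\Big),$$ $$\chi_1(s)=-\dot\chi_2 s+\frac{\dot\chi_2}{2|\dot\chi_2|}\operatorname{arccoth}\!\left(\sqrt{\frac{\dot\phi^2(0)+4\dot\chi_2^2}{4\dot\chi_2^2}}\;\coth\!\Big(s\sqrt{\dot\phi^2(0)+4\dot\chi_2^2}\Big)\right),$$ $$\chi_2(s)=\dot\chi_2 s+\chi_2^{(0)},$$ where the $\operatorname{arccoth}$ term is understood as its limit $0$ at $s=0$.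
   Context: $AdS=\{x\in\mathbb R^4:-x_1^2-x_2^2+x_3^2+x_4^2=-1\}$. Near $(1,0,0,0)$ one uses the parametrization $x_1=\cosh\phi\cosh\chi_1$, $x_2=\sinh\phi\sinh\chi_2$, $x_3=\sinh\phi\cosh\chi_2$, $x_4=\cosh\phi\sinh\chi_1$, with $\phi,\chi_1,\chi_2\in\mathbb R$. In this theorem the geodesics are the projections $(\phi,\chi_1,\chi_2)$ of solutions of the Hamiltonian system with Hamiltonian $$H(\phi,\chi_1,\chi_2,\psi,\xi_1,\xi_2)=\tfrac12\big(4\psi^2-\xi_1^2\tanh^2\phi-\xi_2^2\coth^2\phi+2\xi_1\xi_2\big),$$ where $\psi,\xi_1,\xi_2$ are the momenta conjugate to $\phi,\chi_1,\chi_2$, with $\xi_2=0$. That is, $\xi_1$ is a constant, $\xi_2=0$, and $$\dot\chi_1=-\xi_1\tanh^2\phi,\quad \dot\chi_2=\xi_1,\quad \dot\phi=4\psi,\quad \dot\psi=\xi_1^2\frac{\tanh\phi}{\cosh^2\phi}.$$ The condition $\dot\phi(0)\neq0$ is what the paper means by the geodesic being spacelike. *)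

theory Defs
  imports "HOL-Analysis.Analysis"
begin

definition coth :: "real \<Rightarrow> real" where
  "coth x = cosh x / sinh x"

definition arcoth :: "real \<Rightarrow> real" where
  "arcoth y = ln ((y + 1) / (y - 1)) / 2"

lemma arcoth_coth:
  assumes "x \<noteq> 0"
  shows "arcoth (coth x) = x"
proof -
  have ne: "sinh x \<noteq> 0" using assms by simp
  have "(coth x + 1) / (coth x - 1) = (cosh x + sinh x) / (cosh x - sinh x)"
    using ne by (simp add: coth_def add_divide_eq_iff diff_divide_eq_iff divide_add_eq_iff divide_diff_eq_iff)
  also have "\<dots> = exp x / exp (- x)"
    by (simp add: cosh_plus_sinh cosh_minus_sinh)
  also have "\<dots> = exp (2 * x)"
    by (simp flip: exp_diff)
  finally show ?thesis by (simp add: arcoth_def)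
qed

(* The library's 1 / 0 = 0 makes coth 0 = 0, so that the last-but-one term of the
   Hamiltonian is 0 at \<phi> = 0.  This is used only for \<xi>\<^sub>2 = 0, where the term and its partial
   derivatives vanish for all \<phi> \<noteq> 0 and hence extend by 0 to \<phi> = 0; the resulting equations,
   valid also at \<phi> = 0, are those of geodesic_iff below. *)
definition hamiltonian :: "real \<Rightarrow> real \<Rightarrow> real \<Rightarrow> real \<Rightarrow> real \<Rightarrow> real \<Rightarrow> real" where
  "hamiltonian \<phi> \<chi>\<^sub>1 \<chi>\<^sub>2 \<psi> \<xi>\<^sub>1 \<xi>\<^sub>2 =
     (4 * \<psi>\<^sup>2 - \<xi>\<^sub>1\<^sup>2 * (tanh \<phi>)\<^sup>2 - \<xi>\<^sub>2\<^sup>2 * (coth \<phi>)\<^sup>2 + 2 * \<xi>\<^sub>1 * \<xi>\<^sub>2) / 2"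

definition hamilton_solution ::
  "real set \<Rightarrow> (real \<Rightarrow> real) \<Rightarrow> (real \<Rightarrow> real) \<Rightarrow> (real \<Rightarrow> real) \<Rightarrow>
   (real \<Rightarrow> real) \<Rightarrow> (real \<Rightarrow> real) \<Rightarrow> (real \<Rightarrow> real) \<Rightarrow> bool" where
  "hamilton_solution I \<phi> \<chi>\<^sub>1 \<chi>\<^sub>2 \<psi> \<xi>\<^sub>1 \<xi>\<^sub>2 \<longleftrightarrow> (\<forall>s\<in>I.
     (\<phi> has_real_derivative
        deriv (\<lambda>u. hamiltonian (\<phi> s) (\<chi>\<^sub>1 s) (\<chi>\<^sub>2 s) u (\<xi>\<^sub>1 s) (\<xi>\<^sub>2 s)) (\<psi> s)) (at s) \<and>
     (\<chi>\<^sub>1 has_real_derivative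
        deriv (\<lambda>u. hamiltonian (\<phi> s) (\<chi>\<^sub>1 s) (\<chi>\<^sub>2 s) (\<psi> s) u (\<xi>\<^sub>2 s)) (\<xi>\<^sub>1 s)) (at s) \<and>
     (\<chi>\<^sub>2 has_real_derivative
        deriv (\<lambda>u. hamiltonian (\<phi> s) (\<chi>\<^sub>1 s) (\<chi>\<^sub>2 s) (\<psi> s) (\<xi>\<^sub>1 s) u) (\<xi>\<^sub>2 s)) (at s) \<and>
     (\<psi> has_real_derivative
        - deriv (\<lambda>u. hamiltonian u (\<chi>\<^sub>1 s) (\<chi>\<^sub>2 s) (\<psi> s) (\<xi>\<^sub>1 s) (\<xi>\<^sub>2 s)) (\<phi> s)) (at s) \<and>
     (\<xi>\<^sub>1 has_real_derivative
        - deriv (\<lambda>u. hamiltonian (\<phi> s) u (\<chi>\<^sub>2 s) (\<psi> s) (\<xi>\<^sub>1 s) (\<xi>\<^sub>2 s)) (\<chi>\<^sub>1 s)) (at s) \<and>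
     (\<xi>\<^sub>2 has_real_derivative
        - deriv (\<lambda>u. hamiltonian (\<phi> s) (\<chi>\<^sub>1 s) u (\<psi> s) (\<xi>\<^sub>1 s) (\<xi>\<^sub>2 s)) (\<chi>\<^sub>2 s)) (at s))"

definition geodesic ::
  "real set \<Rightarrow> (real \<Rightarrow> real) \<Rightarrow> (real \<Rightarrow> real) \<Rightarrow> (real \<Rightarrow> real) \<Rightarrow> bool" where
  "geodesic I \<phi> \<chi>\<^sub>1 \<chi>\<^sub>2 \<longleftrightarrow>
     (\<exists>\<psi> \<xi>\<^sub>1. hamilton_solution I \<phi> \<chi>\<^sub>1 \<chi>\<^sub>2 \<psi> \<xi>\<^sub>1 (\<lambda>s. 0))"

lemma deriv_hamiltonian:
  "deriv (\<lambda>u. hamiltonian \<phi> \<chi>\<^sub>1 \<chi>\<^sub>2 u \<xi>\<^sub>1 0) \<psi> = 4 * \<psi>"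
  "deriv (\<lambda>u. hamiltonian \<phi> \<chi>\<^sub>1 \<chi>\<^sub>2 \<psi> u 0) \<xi>\<^sub>1 = - \<xi>\<^sub>1 * (tanh \<phi>)\<^sup>2"
  "deriv (\<lambda>u. hamiltonian \<phi> \<chi>\<^sub>1 \<chi>\<^sub>2 \<psi> \<xi>\<^sub>1 u) 0 = \<xi>\<^sub>1"
  "deriv (\<lambda>u. hamiltonian u \<chi>\<^sub>1 \<chi>\<^sub>2 \<psi> \<xi>\<^sub>1 0) \<phi> = - (\<xi>\<^sub>1\<^sup>2 * tanh \<phi> / (cosh \<phi>)\<^sup>2)"
  "deriv (\<lambda>u. hamiltonian \<phi> u \<chi>\<^sub>2 \<psi> \<xi>\<^sub>1 \<xi>\<^sub>2) \<chi>\<^sub>1 = 0"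
  "deriv (\<lambda>u. hamiltonian \<phi> \<chi>\<^sub>1 u \<psi> \<xi>\<^sub>1 \<xi>\<^sub>2) \<chi>\<^sub>2 = 0"
proof -
  have sech: "1 - (tanh \<phi>)\<^sup>2 = 1 / (cosh \<phi>)\<^sup>2"
  proof -
    have "1 - (tanh \<phi>)\<^sup>2 = ((cosh \<phi>)\<^sup>2 - (sinh \<phi>)\<^sup>2) / (cosh \<phi>)\<^sup>2"
      by (simp add: tanh_def power_divide diff_divide_distrib)
    then show ?thesis by (simp add: cosh_square_eq)
  qed
  show "deriv (\<lambda>u. hamiltonian \<phi> \<chi>\<^sub>1 \<chi>\<^sub>2 u \<xi>\<^sub>1 0) \<psi> = 4 * \<psi>"
    unfolding hamiltonian_def
    by (rule DERIV_imp_deriv) (auto intro!: derivative_eq_intros)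
  show "deriv (\<lambda>u. hamiltonian \<phi> \<chi>\<^sub>1 \<chi>\<^sub>2 \<psi> u 0) \<xi>\<^sub>1 = - \<xi>\<^sub>1 * (tanh \<phi>)\<^sup>2"
    unfolding hamiltonian_def
    by (rule DERIV_imp_deriv) (auto intro!: derivative_eq_intros)
  show "deriv (\<lambda>u. hamiltonian \<phi> \<chi>\<^sub>1 \<chi>\<^sub>2 \<psi> \<xi>\<^sub>1 u) 0 = \<xi>\<^sub>1"
    unfolding hamiltonian_def
    by (rule DERIV_imp_deriv) (auto intro!: derivative_eq_intros)
  have "((\<lambda>u. hamiltonian u \<chi>\<^sub>1 \<chi>\<^sub>2 \<psi> \<xi>\<^sub>1 0) has_real_derivative
          - (\<xi>\<^sub>1\<^sup>2 * (tanh \<phi> * (1 - (tanh \<phi>)\<^sup>2)))) (at \<phi>)"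
    unfolding hamiltonian_def
    by (auto intro!: derivative_eq_intros)
  then show "deriv (\<lambda>u. hamiltonian u \<chi>\<^sub>1 \<chi>\<^sub>2 \<psi> \<xi>\<^sub>1 0) \<phi> = - (\<xi>\<^sub>1\<^sup>2 * tanh \<phi> / (cosh \<phi>)\<^sup>2)"
    unfolding sech by (simp add: DERIV_imp_deriv)
  show "deriv (\<lambda>u. hamiltonian \<phi> u \<chi>\<^sub>2 \<psi> \<xi>\<^sub>1 \<xi>\<^sub>2) \<chi>\<^sub>1 = 0"
    "deriv (\<lambda>u. hamiltonian \<phi> \<chi>\<^sub>1 u \<psi> \<xi>\<^sub>1 \<xi>\<^sub>2) \<chi>\<^sub>2 = 0"
    by (simp_all add: hamiltonian_def)
qed

lemma geodesic_iff:
  assumes "open I" "is_interval I"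
  shows "geodesic I \<phi> \<chi>\<^sub>1 \<chi>\<^sub>2 \<longleftrightarrow> (\<exists>\<psi> \<xi>\<^sub>1. \<forall>s\<in>I.
    (\<chi>\<^sub>1 has_real_derivative - \<xi>\<^sub>1 * (tanh (\<phi> s))\<^sup>2) (at s) \<and>
    (\<chi>\<^sub>2 has_real_derivative \<xi>\<^sub>1) (at s) \<and>
    (\<phi> has_real_derivative 4 * \<psi> s) (at s) \<and>
    (\<psi> has_real_derivative \<xi>\<^sub>1\<^sup>2 * tanh (\<phi> s) / (cosh (\<phi> s))\<^sup>2) (at s))"
    (is "_ \<longleftrightarrow> (\<exists>\<psi> \<xi>\<^sub>1. ?E \<psi> \<xi>\<^sub>1)")
proof
  assume "geodesic I \<phi> \<chi>\<^sub>1 \<chi>\<^sub>2"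
  then obtain \<psi> \<xi> where h: "hamilton_solution I \<phi> \<chi>\<^sub>1 \<chi>\<^sub>2 \<psi> \<xi> (\<lambda>s. 0)"
    by (auto simp: geodesic_def)
  have "\<forall>s\<in>I. (\<xi> has_real_derivative 0) (at s within I)"
    using h by (auto simp: hamilton_solution_def deriv_hamiltonian intro: has_field_derivative_at_within)
  then obtain k where "\<forall>s\<in>I. \<xi> s = k"
    using has_field_derivative_zero_constant[of I \<xi>] assms(2)
    by (auto simp: is_interval_convex_1)
  then have "?E \<psi> k"
    using h by (auto simp: hamilton_solution_def deriv_hamiltonian)
  then show "\<exists>\<psi> \<xi>\<^sub>1. ?E \<psi> \<xi>\<^sub>1" by blast
next
  assume "\<exists>\<psi> \<xi>\<^sub>1. ?E \<psi> \<xi>\<^sub>1"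
  then obtain \<psi> k where "?E \<psi> k" by blast
  then have "hamilton_solution I \<phi> \<chi>\<^sub>1 \<chi>\<^sub>2 \<psi> (\<lambda>s. k) (\<lambda>s. 0)"
    by (auto simp: hamilton_solution_def deriv_hamiltonian)
  then show "geodesic I \<phi> \<chi>\<^sub>1 \<chi>\<^sub>2" by (auto simp: geodesic_def)
qed

end

theory Submission
  imports Defs
begin

text \<open>Along a geodesic, \<open>\<phi>'\<^sup>2 - 4 c\<^sup>2 tanh\<^sup>2 \<phi>\<close> is conserved, hence equal to \<open>v\<^sup>2\<close>. This turns the nonlinear
  equation for \<open>\<phi>\<close> into the linear equation \<open>y'' = (v\<^sup>2 + 4 c\<^sup>2) y\<close> for \<open>y = sinh \<phi>\<close>. Since
  \<open>\<chi>\<^sub>1' = - c + c / cosh\<^sup>2 \<phi>\<close> and \<open>cosh\<^sup>2 \<phi> = 1 + y\<^sup>2\<close>, the formula for \<open>\<chi>\<^sub>1\<close> then follows by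
  comparing derivatives.\<close>

text \<open>This is the integration step used throughout: it yields conservation laws as well as
  explicit primitives. The difference of the two functions has zero derivative on the convex set
  \<open>I\<close>, hence is constant, and it vanishes at \<open>a\<close>.\<close>

lemma is_interval_DERIV_eq:
  fixes f g f' :: "real \<Rightarrow> real"
  assumes "is_interval I" "a \<in> I" "f a = g a"
    and "\<And>s. s \<in> I \<Longrightarrow> (f has_real_derivative f' s) (at s)"
    and "\<And>s. s \<in> I \<Longrightarrow> (g has_real_derivative f' s) (at s)"
    and "s \<in> I"
  shows "f s = g s"
proof -
  have "\<forall>s\<in>I. ((\<lambda>s. f s - g s) has_real_derivative 0) (at s within I)"
    using DERIV_diff[OF assms(4) assms(5)]
    by (auto intro: has_field_derivative_at_within)
  then obtain k where "\<forall>s\<in>I. f s - g s = k"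
    using has_field_derivative_zero_constant[of I "\<lambda>s. f s - g s"] assms(1)
    by (auto simp: is_interval_convex_1)
  then show ?thesis using assms(2,3,6) by (metis eq_iff_diff_eq_0)
qed

text \<open>The operator \<open>D^2 - w^2\<close> factors as \<open>(D - u) (D + u)\<close> with
  \<open>u = w\<close> or \<open>u = - w\<close>. So \<open>z + u * y\<close> solves a first-order
  equation and is a multiple of \<open>exp (u * s)\<close>; subtracting the two cases isolates
  \<open>y\<close>.\<close>

lemma linear_ode_sinh:
  fixes y z :: "real \<Rightarrow> real" and w :: real
  assumes "is_interval I" "0 \<in> I" "w \<noteq> 0" "y 0 = 0" "s \<in> I"
    and y: "\<And>s. s \<in> I \<Longrightarrow> (y has_real_derivative z s) (at s)"
    and z: "\<And>s. s \<in> I \<Longrightarrow> (z has_real_derivative w\<^sup>2 * y s) (at s)"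
  shows "y s = z 0 / w * sinh (s * w)"
proof -
  \<comment> \<open>At \<open>s = 0\<close> the left side is \<open>z 0\<close> for either sign of
    \<open>u\<close>, because \<open>y 0 = 0\<close>.\<close>
  have first_integral: "(z s + u * y s) * exp (- u * s) = z 0" if "u\<^sup>2 = w\<^sup>2" for u
  proof (rule is_interval_DERIV_eq[where I = I and a = 0 and f' = "\<lambda>_. 0"
        and f = "\<lambda>s. (z s + u * y s) * exp (- u * s)" and g = "\<lambda>_. z 0"])
    fix s assume "s \<in> I"
    have "w\<^sup>2 * y s = u * (u * y s)"
      unfolding that[symmetric] by (simp add: power2_eq_square)
    then show "((\<lambda>s. (z s + u * y s) * exp (- u * s)) has_real_derivative 0) (at s)"
      by (auto intro!: derivative_eq_intros y z \<open>s \<in> I\<close> simp: algebra_simps)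
  qed (use assms in auto)
  have "z s + w * y s = z 0 * exp (w * s)" "z s - w * y s = z 0 * exp (- w * s)"
    using first_integral[of w] first_integral[of "- w"]
    by (simp_all add: exp_minus field_simps)
  then have "2 * w * y s = z 0 * (exp (w * s) - exp (- w * s))"
    by (simp add: algebra_simps)
  then show ?thesis
    using \<open>w \<noteq> 0\<close> by (simp add: sinh_field_def field_simps)
qed

text \<open>Multiplying numerator and denominator by \<open>y\<close> turns one logarithm into the
  other; at \<open>y = 1\<close> both quotients are 0 by division by zero. The lemma replaces an
  expression singular at \<open>s = 0\<close> by one that is smooth there.\<close>

lemma arcoth_eq_artanh_inverse:
  assumes "y \<noteq> 0"
  shows "arcoth y = artanh (inverse y)"
proof -
  have "(1 + inverse y) / (1 - inverse y) = (y + 1) / (y - 1)"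
    using assms by (cases "y = 1") (auto simp: field_simps)
  then show ?thesis by (simp add: arcoth_def artanh_def)
qed

lemma one_minus_tanh_square: "1 - (tanh x)\<^sup>2 = 1 / (cosh x)\<^sup>2" for x :: real
proof -
  have "1 - (tanh x)\<^sup>2 = ((cosh x)\<^sup>2 - (sinh x)\<^sup>2) / (cosh x)\<^sup>2"
    by (simp add: tanh_def power_divide diff_divide_distrib)
  then show ?thesis by (simp add: cosh_square_eq)
qed

text \<open>The bound on \<open>k\<close> keeps the argument of \<open>artanh\<close> inside (-1,
  1). Expanding the chain-rule fraction by \<open>cosh^2\<close> gives a denominator in
  \<open>sinh\<close> alone, the form in which \<open>cosh^2 \<phi>\<close> appears along the
  geodesic.\<close>

lemma DERIV_artanh_mult_tanh:
  fixes k w s :: real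
  assumes "\<bar>k\<bar> \<le> 1"
  shows "((\<lambda>s. artanh (k * tanh (s * w))) has_real_derivative
          k * w / (1 + (1 - k\<^sup>2) * (sinh (s * w))\<^sup>2)) (at s)"
proof -
  have "\<bar>tanh (s * w)\<bar> < 1"
    using tanh_real_bounds[of "s * w"] by auto
  then have lt: "\<bar>k * tanh (s * w)\<bar> < 1"
    using assms mult_right_mono[of "\<bar>k\<bar>" 1 "\<bar>tanh (s * w)\<bar>"] by (simp add: abs_mult)
  have "(tanh (s * w))\<^sup>2 * (cosh (s * w))\<^sup>2 = (sinh (s * w))\<^sup>2"
    by (simp add: tanh_def power_divide)
  have num: "(1 - (tanh (s * w))\<^sup>2) * (cosh (s * w))\<^sup>2 = 1"
    by (simp add: one_minus_tanh_square)
  have den: "(1 - (k * tanh (s * w))\<^sup>2) * (cosh (s * w))\<^sup>2 = 1 + (1 - k\<^sup>2) * (sinh (s * w))\<^sup>2"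
    using cosh_square_eq[of "s * w"] \<open>(tanh (s * w))\<^sup>2 * (cosh (s * w))\<^sup>2 = (sinh (s * w))\<^sup>2\<close>
    by (simp add: power_mult_distrib algebra_simps)
  have "1 / (1 - (k * tanh (s * w))\<^sup>2) * (k * ((1 - (tanh (s * w))\<^sup>2) * w))
      = k * w * (((1 - (tanh (s * w))\<^sup>2) * (cosh (s * w))\<^sup>2) / ((1 - (k * tanh (s * w))\<^sup>2) * (cosh (s * w))\<^sup>2))"
    by simp
  also have "\<dots> = k * w / (1 + (1 - k\<^sup>2) * (sinh (s * w))\<^sup>2)"
    unfolding num den by simp
  finally have "1 / (1 - (k * tanh (s * w))\<^sup>2) * (k * ((1 - (tanh (s * w))\<^sup>2) * w))
      = k * w / (1 + (1 - k\<^sup>2) * (sinh (s * w))\<^sup>2)" .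
  moreover have "((\<lambda>s. artanh (k * tanh (s * w))) has_real_derivative
      1 / (1 - (k * tanh (s * w))\<^sup>2) * (k * ((1 - (tanh (s * w))\<^sup>2) * w))) (at s)"
    by (rule DERIV_chain2[OF artanh_real_has_field_derivative])
      (use lt in \<open>auto intro!: derivative_eq_intros\<close>)
  ultimately show ?thesis by simp
qed

theorem theorem6:
  fixes I :: "real set"
    and \<phi> \<chi>\<^sub>1 \<chi>\<^sub>2 :: "real \<Rightarrow> real"
    and v c \<chi>\<^sub>2\<^sub>0 :: real
  assumes "open I" and "is_interval I" and "0 \<in> I"
    and "geodesic I \<phi> \<chi>\<^sub>1 \<chi>\<^sub>2"
    and "\<phi> 0 = 0" and "\<chi>\<^sub>1 0 = 0" and "\<chi>\<^sub>2 0 = \<chi>\<^sub>2\<^sub>0"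
    and "(\<phi> has_real_derivative v) (at 0)" and "v \<noteq> 0"
    and "\<forall>s\<in>I. (\<chi>\<^sub>2 has_real_derivative c) (at s)" and "c \<noteq> 0"
  shows "(\<exists>\<sigma>\<in>{1, -1}. \<forall>s\<in>I.
            sinh (\<phi> s) = \<sigma> * sqrt (v\<^sup>2 / (v\<^sup>2 + 4 * c\<^sup>2)) * sinh (s * sqrt (v\<^sup>2 + 4 * c\<^sup>2)))
       \<and> (\<forall>s\<in>I. \<chi>\<^sub>1 s = - c * s + c / (2 * \<bar>c\<bar>) *
            (if s = 0 then 0
             else arcoth (sqrt ((v\<^sup>2 + 4 * c\<^sup>2) / (4 * c\<^sup>2)) * coth (s * sqrt (v\<^sup>2 + 4 * c\<^sup>2)))))
       \<and> (\<forall>s\<in>I. \<chi>\<^sub>2 s = c * s + \<chi>\<^sub>2\<^sub>0)"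
proof -
  define w where "w = sqrt (v\<^sup>2 + 4 * c\<^sup>2)"
  have w2: "w\<^sup>2 = v\<^sup>2 + 4 * c\<^sup>2" and "w > 0"
    using \<open>v \<noteq> 0\<close> by (auto simp: w_def add_pos_nonneg)
  obtain \<psi> \<xi> where geo: "\<forall>s\<in>I.
      (\<chi>\<^sub>1 has_real_derivative - \<xi> * (tanh (\<phi> s))\<^sup>2) (at s) \<and>
      (\<chi>\<^sub>2 has_real_derivative \<xi>) (at s) \<and>
      (\<phi> has_real_derivative 4 * \<psi> s) (at s) \<and>
      (\<psi> has_real_derivative \<xi>\<^sup>2 * tanh (\<phi> s) / (cosh (\<phi> s))\<^sup>2) (at s)"
    using \<open>geodesic I \<phi> \<chi>\<^sub>1 \<chi>\<^sub>2\<close> geodesic_iff[OF \<open>open I\<close> \<open>is_interval I\<close>] by blast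
  have "\<xi> = c"
    using geo assms(3,10) DERIV_unique by blast
  have \<psi>0: "4 * \<psi> 0 = v"
    using geo assms(3,8) DERIV_unique by blast
  have D\<chi>: "(\<chi>\<^sub>1 has_real_derivative - c * (tanh (\<phi> s))\<^sup>2) (at s)"
    and D\<phi>: "(\<phi> has_real_derivative 4 * \<psi> s) (at s)"
    and D\<psi>: "(\<psi> has_real_derivative c\<^sup>2 * tanh (\<phi> s) / (cosh (\<phi> s))\<^sup>2) (at s)" if "s \<in> I" for s
    using geo that \<open>\<xi> = c\<close> by auto
  \<comment> \<open>Conservation of the Hamiltonian: at \<open>\<xi>\<^sub>2 = 0\<close>, eight
    times it is \<open>(4 * \<psi>)^2 - 4 * c^2 * tanh^2 \<phi>\<close>. The value
    \<open>v^2\<close> is read off at \<open>s = 0\<close>.\<close>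
  have energy: "(4 * \<psi> s)\<^sup>2 = v\<^sup>2 + 4 * c\<^sup>2 * (tanh (\<phi> s))\<^sup>2" if "s \<in> I" for s
  proof (rule is_interval_DERIV_eq[OF \<open>is_interval I\<close> \<open>0 \<in> I\<close> _ _ _ that,
        where f' = "\<lambda>s. 32 * c\<^sup>2 * \<psi> s * tanh (\<phi> s) / (cosh (\<phi> s))\<^sup>2"])
    show "(4 * \<psi> 0)\<^sup>2 = v\<^sup>2 + 4 * c\<^sup>2 * (tanh (\<phi> 0))\<^sup>2"
      using \<psi>0 \<open>\<phi> 0 = 0\<close> by simp
    fix s assume "s \<in> I"
    show "((\<lambda>s. (4 * \<psi> s)\<^sup>2) has_real_derivative
        32 * c\<^sup>2 * \<psi> s * tanh (\<phi> s) / (cosh (\<phi> s))\<^sup>2) (at s)"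
      by (auto intro!: derivative_eq_intros D\<psi> \<open>s \<in> I\<close>)
    show "((\<lambda>s. v\<^sup>2 + 4 * c\<^sup>2 * (tanh (\<phi> s))\<^sup>2) has_real_derivative
        32 * c\<^sup>2 * \<psi> s * tanh (\<phi> s) / (cosh (\<phi> s))\<^sup>2) (at s)"
      by (auto intro!: derivative_eq_intros D\<phi> \<open>s \<in> I\<close> simp: one_minus_tanh_square)
  qed
  have sinh\<phi>: "sinh (\<phi> s) = v / w * sinh (s * w)" if "s \<in> I" for s
  proof -
    have "sinh (\<phi> s) = cosh (\<phi> 0) * (4 * \<psi> 0) / w * sinh (s * w)"
    proof (rule linear_ode_sinh[where I = I and z = "\<lambda>s. cosh (\<phi> s) * (4 * \<psi> s)"])
      fix s assume "s \<in> I"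
      show "((\<lambda>s. sinh (\<phi> s)) has_real_derivative cosh (\<phi> s) * (4 * \<psi> s)) (at s)"
        by (auto intro!: derivative_eq_intros D\<phi> \<open>s \<in> I\<close>)
      \<comment> \<open>The second derivative of \<open>sinh \<phi>\<close> is
        \<open>sinh \<phi> * \<phi>'^2 + cosh \<phi> * \<phi>''\<close>. After inserting the
        conserved energy, the \<open>tanh^2\<close> terms of the two summands cancel.\<close>
      have "sinh (\<phi> s) * (4 * \<psi> s)\<^sup>2 + 4 * c\<^sup>2 * sinh (\<phi> s) * (1 - (tanh (\<phi> s))\<^sup>2) = w\<^sup>2 * sinh (\<phi> s)"
        unfolding energy[OF \<open>s \<in> I\<close>] w2 by (simp add: algebra_simps)
      moreover have "cosh (\<phi> s) * (4 * (c\<^sup>2 * tanh (\<phi> s) / (cosh (\<phi> s))\<^sup>2))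
          = 4 * c\<^sup>2 * sinh (\<phi> s) * (1 - (tanh (\<phi> s))\<^sup>2)"
        unfolding one_minus_tanh_square by (simp add: tanh_def)
      ultimately have "sinh (\<phi> s) * (4 * \<psi> s) * (4 * \<psi> s)
          + cosh (\<phi> s) * (4 * (c\<^sup>2 * tanh (\<phi> s) / (cosh (\<phi> s))\<^sup>2)) = w\<^sup>2 * sinh (\<phi> s)"
        by (simp add: power2_eq_square)
      then show "((\<lambda>s. cosh (\<phi> s) * (4 * \<psi> s)) has_real_derivative w\<^sup>2 * sinh (\<phi> s)) (at s)"
        by (auto intro!: derivative_eq_intros D\<phi> D\<psi> \<open>s \<in> I\<close> simp: algebra_simps)
    qed (use assms(2,3,5) that \<open>w > 0\<close> in auto)
    then show ?thesis using \<psi>0 \<open>\<phi> 0 = 0\<close> by simp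
  qed
  \<comment> \<open>\<open>k\<close> is the reciprocal of the factor in front of
    \<open>coth\<close>. By \<open>k2\<close> below, \<open>1 - k^2\<close> is the squared amplitude
    of \<open>sinh \<phi>\<close>, which makes \<open>cosh^2 \<phi>\<close> the denominator in
    \<open>DERIV_artanh_mult_tanh\<close>.\<close>
  define k where "k = 2 * \<bar>c\<bar> / w"
  have "v\<^sup>2 = w\<^sup>2 - 4 * c\<^sup>2"
    using w2 by simp
  then have k2: "1 - k\<^sup>2 = (v / w)\<^sup>2"
    using \<open>w > 0\<close> by (simp add: k_def power_divide power_mult_distrib diff_divide_distrib)
  then have "k\<^sup>2 \<le> 1"
    by (metis diff_ge_0_iff_ge zero_le_power2)
  then have "\<bar>k\<bar> \<le> 1"
    by (simp add: abs_square_le_1)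
  \<comment> \<open>Working with \<open>artanh\<close> first lets \<open>s = 0\<close> be treated
    like every other point of \<open>I\<close>.\<close>
  have \<chi>1: "\<chi>\<^sub>1 s = - c * s + c / (2 * \<bar>c\<bar>) * artanh (k * tanh (s * w))" if "s \<in> I" for s
  proof (rule is_interval_DERIV_eq[OF \<open>is_interval I\<close> \<open>0 \<in> I\<close> _ D\<chi> _ that])
    show "\<chi>\<^sub>1 0 = - c * 0 + c / (2 * \<bar>c\<bar>) * artanh (k * tanh (0 * w))"
      using \<open>\<chi>\<^sub>1 0 = 0\<close> by simp
    fix s assume "s \<in> I"
    have "(cosh (\<phi> s))\<^sup>2 = 1 + (1 - k\<^sup>2) * (sinh (s * w))\<^sup>2"
      by (simp add: cosh_square_eq sinh\<phi>[OF \<open>s \<in> I\<close>] k2 power_mult_distrib power_divide)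
    then have "((\<lambda>s. artanh (k * tanh (s * w))) has_real_derivative k * w * (1 - (tanh (\<phi> s))\<^sup>2)) (at s)"
      using DERIV_artanh_mult_tanh[OF \<open>\<bar>k\<bar> \<le> 1\<close>, of w s] by (simp add: one_minus_tanh_square)
    moreover have "k * w = 2 * \<bar>c\<bar>"
      using \<open>w > 0\<close> by (simp add: k_def)
    ultimately have D: "((\<lambda>s. artanh (k * tanh (s * w))) has_real_derivative
        2 * \<bar>c\<bar> * (1 - (tanh (\<phi> s))\<^sup>2)) (at s)"
      by simp
    have eq: "- c + c / (2 * \<bar>c\<bar>) * (2 * \<bar>c\<bar> * (1 - (tanh (\<phi> s))\<^sup>2)) = - c * (tanh (\<phi> s))\<^sup>2"
      using \<open>c \<noteq> 0\<close> by (simp add: right_diff_distrib)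
    show "((\<lambda>s. - c * s + c / (2 * \<bar>c\<bar>) * artanh (k * tanh (s * w))) has_real_derivative
        - c * (tanh (\<phi> s))\<^sup>2) (at s)"
      unfolding eq[symmetric] by (rule DERIV_add[OF DERIV_cmult_Id DERIV_cmult[OF D]])
  qed
  have "sqrt ((v\<^sup>2 + 4 * c\<^sup>2) / (4 * c\<^sup>2)) = inverse k"
    by (simp add: k_def w_def real_sqrt_divide real_sqrt_mult)
  \<comment> \<open>At \<open>s = 0\<close> both sides are 0. Otherwise the argument of
    \<open>arcoth\<close> is nonzero, since \<open>cosh\<close> is positive and
    \<open>c \<noteq> 0\<close>, and its inverse is \<open>k * tanh (s * w)\<close>.\<close>
  then have artanh_k: "artanh (k * tanh (s * w)) = (if s = 0 then 0
      else arcoth (sqrt ((v\<^sup>2 + 4 * c\<^sup>2) / (4 * c\<^sup>2)) * coth (s * w)))" for s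
    using \<open>w > 0\<close> \<open>c \<noteq> 0\<close>
    by (simp add: arcoth_eq_artanh_inverse coth_def tanh_def k_def)
  have "sqrt (v\<^sup>2 / (v\<^sup>2 + 4 * c\<^sup>2)) = \<bar>v\<bar> / w"
    by (simp add: w_def real_sqrt_divide)
  \<comment> \<open>The square root only sees \<open>\<bar>v\<bar>\<close>, so the sign to choose is
    that of the initial velocity, the same for all \<open>s\<close>.\<close>
  then have "\<forall>s\<in>I. sinh (\<phi> s) = sgn v * sqrt (v\<^sup>2 / (v\<^sup>2 + 4 * c\<^sup>2)) * sinh (s * w)"
    using sinh\<phi> by (simp add: sgn_mult_abs)
  moreover have "sgn v \<in> {1, -1}"
    using \<open>v \<noteq> 0\<close> by (simp add: sgn_if)
  moreover have "\<forall>s\<in>I. \<chi>\<^sub>1 s = - c * s + c / (2 * \<bar>c\<bar>) * (if s = 0 then 0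
      else arcoth (sqrt ((v\<^sup>2 + 4 * c\<^sup>2) / (4 * c\<^sup>2)) * coth (s * w)))"
    using \<chi>1 unfolding artanh_k by blast
  moreover have "\<chi>\<^sub>2 s = c * s + \<chi>\<^sub>2\<^sub>0" if "s \<in> I" for s
  proof (rule is_interval_DERIV_eq[OF \<open>is_interval I\<close> \<open>0 \<in> I\<close> _ _ _ that,
        where f = \<chi>\<^sub>2 and g = "\<lambda>s. c * s + \<chi>\<^sub>2\<^sub>0" and f' = "\<lambda>_. c"])
    show "((\<lambda>s. c * s + \<chi>\<^sub>2\<^sub>0) has_real_derivative c) (at s)" for s
      by (auto intro!: derivative_eq_intros)
  qed (use assms(7,10) in auto)
  ultimately show ?thesis
    unfolding w_def by (intro conjI bexI[of _ "sgn v"]) simp_all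
qed

end
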